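(* For every NICD instance $(T,\rho,n,S)$ on a tree there is an optimal protocol $(f_v)_{v\in S}$ in which all players use a monotone function, i.e. every $f_v$ is monotone.
   Context: NICD on trees. An instance consists of a finite undirected tree $T$, a correlation parameter $\rho\in(0,1)$, an integer $n\ge1$ and a set of players $S\subseteq V(T)$. Random strings $x^{(v)}\in\{-1,1\}^n$, $v\in V(T)$, are generated as follows: the $n$ coordinates are independent, and for each coordinate $i$ the vector $\alpha=(x^{(v)}_i)_{v\in V(T)}\in\{-1,1\}^{V(T)}$ has probability $\mathbf{P}(\alpha)=\frac12(\frac12+\frac12\rho)^{A(\alpha)}(\frac12-\frac12\rho)^{B(\alpha)}$, where $A(\alpha)$, $B(\alpha)$ are the numbers of edges of $T$ whose endpoints agree, respectively disagree, in $\alpha$. A function $f:\{-1,1\}^n\to\{-1,1\}$ is balanced if it takes each value on exactly $2^{n-1}$ inputs. A protocol is a family $(f_v)_{v\in S}$ of balanced functions. $\mathcal{P}(T,\rho,n,S,(f_v)_{v\in S})$ is the probability that all the bits $f_v(x^{(v)})$, $v\in S$, are equal. Define $\mathcal{M}(T,\rho,n,S)=\sup_{(f_v)}\mathcal{P}(T,\rho,n,S,(f_v))$ over all protocols. A protocol is optimal for $(T,\rho,n,S)$ if it attains $\mathcal{M}(T,\rho,n,S)$. A function $f:\{-1,1\}^n\to\{-1,1\}$ is monotone if $f(x)\le f(y)$ whenever $x_i\le y_i$ for all $i$. *)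

theory Defs
  imports "HOL-Analysis.Analysis"
begin

text \<open>A finite simple undirected graph is given by its vertex set \<open>V\<close> and its set \<open>E\<close> of
  two-element edges.\<close>

definition simple_graph :: "'v set \<Rightarrow> 'v set set \<Rightarrow> bool" where
  "simple_graph V E \<longleftrightarrow> finite V \<and> (\<forall>e\<in>E. e \<subseteq> V \<and> card e = 2)"

definition graph_connected :: "'v set \<Rightarrow> 'v set set \<Rightarrow> bool" where
  "graph_connected V E \<longleftrightarrow> V \<noteq> {} \<and> (\<forall>u\<in>V. \<forall>v\<in>V. (u, v) \<in> {(a, b). {a, b} \<in> E}\<^sup>*)"

text \<open>A cycle is listed by its distinct vertices; the edge from the last vertex back to the first
  one closes it.\<close>

definition graph_cycle :: "'v set set \<Rightarrow> 'v list \<Rightarrow> bool" where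
  "graph_cycle E p \<longleftrightarrow>
     length p \<ge> 3 \<and> distinct p \<and> successively (\<lambda>u v. {u, v} \<in> E) p \<and> {last p, hd p} \<in> E"

definition is_tree :: "'v set \<Rightarrow> 'v set set \<Rightarrow> bool" where
  "is_tree V E \<longleftrightarrow> simple_graph V E \<and> graph_connected V E \<and> (\<nexists>p. graph_cycle E p)"

definition cube :: "nat \<Rightarrow> (nat \<Rightarrow> int) set" where
  "cube n = {..<n} \<rightarrow>\<^sub>E {-1, 1}"

definition balanced :: "nat \<Rightarrow> ((nat \<Rightarrow> int) \<Rightarrow> int) \<Rightarrow> bool" where
  "balanced n f \<longleftrightarrow>
     f \<in> cube n \<rightarrow> {-1, 1} \<and> (\<forall>b\<in>{-1, 1}. card {x \<in> cube n. f x = b} = 2 ^ (n - 1))"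

text \<open>The coordinatewise order is imposed on the coordinates below \<open>n\<close> only.\<close>

definition cube_monotone :: "nat \<Rightarrow> ((nat \<Rightarrow> int) \<Rightarrow> int) \<Rightarrow> bool" where
  "cube_monotone n f \<longleftrightarrow> monotone_on (cube n) (\<lambda>x y. \<forall>i<n. x i \<le> y i) (\<le>) f"

text \<open>The numbers of edges whose endpoints agree, respectively disagree, in \<open>\<alpha>\<close>.\<close>

definition agreements :: "'v set set \<Rightarrow> ('v \<Rightarrow> int) \<Rightarrow> nat" where
  "agreements E \<alpha> = card {e \<in> E. \<forall>u\<in>e. \<forall>v\<in>e. \<alpha> u = \<alpha> v}"

definition disagreements :: "'v set set \<Rightarrow> ('v \<Rightarrow> int) \<Rightarrow> nat" where
  "disagreements E \<alpha> = card {e \<in> E. \<exists>u\<in>e. \<exists>v\<in>e. \<alpha> u \<noteq> \<alpha> v}"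

definition coord_prob :: "'v set set \<Rightarrow> real \<Rightarrow> ('v \<Rightarrow> int) \<Rightarrow> real" where
  "coord_prob E \<rho> \<alpha> =
     1/2 * (1/2 + 1/2 * \<rho>) ^ agreements E \<alpha> * (1/2 - 1/2 * \<rho>) ^ disagreements E \<alpha>"

text \<open>The joint law of the strings \<open>(X v)\<close>, \<open>v \<in> V\<close>, on its finite sample space. Independence of
  the coordinates is expressed by the point masses being products over the coordinates.\<close>

definition nicd_measure ::
    "'v set \<Rightarrow> 'v set set \<Rightarrow> real \<Rightarrow> nat \<Rightarrow> ('v \<Rightarrow> nat \<Rightarrow> int) measure" where
  "nicd_measure V E \<rho> n =
     point_measure (V \<rightarrow>\<^sub>E cube n) (\<lambda>X. ennreal (\<Prod>i<n. coord_prob E \<rho> (\<lambda>v. X v i)))"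

text \<open>Only the restrictions of \<open>f v\<close> to \<open>cube n\<close> for \<open>v \<in> S\<close> matter.\<close>

definition protocol :: "nat \<Rightarrow> 'v set \<Rightarrow> ('v \<Rightarrow> (nat \<Rightarrow> int) \<Rightarrow> int) \<Rightarrow> bool" where
  "protocol n S f \<longleftrightarrow> (\<forall>v\<in>S. balanced n (f v))"

definition agree_prob ::
    "'v set \<Rightarrow> 'v set set \<Rightarrow> real \<Rightarrow> nat \<Rightarrow> 'v set \<Rightarrow> ('v \<Rightarrow> (nat \<Rightarrow> int) \<Rightarrow> int) \<Rightarrow> real" where
  "agree_prob V E \<rho> n S f =
     measure (nicd_measure V E \<rho> n)
       {X \<in> space (nicd_measure V E \<rho> n). \<forall>u\<in>S. \<forall>v\<in>S. f u (X u) = f v (X v)}"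

definition max_agree_prob ::
    "'v set \<Rightarrow> 'v set set \<Rightarrow> real \<Rightarrow> nat \<Rightarrow> 'v set \<Rightarrow> real" where
  "max_agree_prob V E \<rho> n S = (SUP f\<in>{f. protocol n S f}. agree_prob V E \<rho> n S f)"

definition optimal_protocol ::
    "'v set \<Rightarrow> 'v set set \<Rightarrow> real \<Rightarrow> nat \<Rightarrow> 'v set \<Rightarrow> ('v \<Rightarrow> (nat \<Rightarrow> int) \<Rightarrow> int) \<Rightarrow> bool" where
  "optimal_protocol V E \<rho> n S f \<longleftrightarrow>
     protocol n S f \<and> agree_prob V E \<rho> n S f = max_agree_prob V E \<rho> n S"

end

theory Submission
  imports Defs
begin

text \<open>
  The proof is a shifting argument. To shift a function \<open>f\<close> up in coordinate \<open>i\<close> means to sort, for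
  every setting of the other coordinates, its two values along coordinate \<open>i\<close>. This keeps \<open>f\<close>
  balanced, makes it monotone in coordinate \<open>i\<close>, and does not spoil monotonicity in another
  coordinate. If shifting all players' functions at once never lowers the agreement probability,
  then an optimal protocol, which exists because there are only finitely many possible values,
  stays optimal when shifted in one coordinate after the other, and ends up monotone.

  That shifting does not lower the agreement probability can be checked for each setting of the
  coordinates other than \<open>i\<close>, by independence. Then every player \<open>v\<close> applies to its single
  bit \<open>\<alpha> v\<close> one of the four functions from \<open>{-1, 1}\<close> to itself, and shifting just turns negation
  into the identity. For a fixed common value the indicator of agreement is
  a product over the players of affine functions \<open>a v + b v * \<alpha> v\<close> with \<open>a v \<ge> 0\<close>. Expanding
  the product, its expectation is a combination of the moments of the law of \<open>\<alpha>\<close>. These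
  moments are nonnegative (Griffiths' first inequality for ferromagnetic Ising models), since
  the law has density proportional to the product of \<open>1 + \<rho> * \<alpha> u * \<alpha> v\<close> over the edges. So replacing
  each \<open>b v\<close> by its absolute value, which is exactly what sorting does for the common
  value \<open>1\<close>, can only increase the expectation. For the common value \<open>-1\<close>, sorting replaces
  \<open>b v\<close> by \<open>-\<bar>b v\<bar>\<close>, which has the same effect because the law is invariant under a
  global sign change.
\<close>

section \<open>The Ising law of one coordinate\<close>

definition spins :: "'v set \<Rightarrow> ('v \<Rightarrow> int) set" where
  "spins V = V \<rightarrow>\<^sub>E {-1, 1}"

lemma finite_spins: "finite V \<Longrightarrow> finite (spins V)"
  unfolding spins_def by (rule finite_PiE) auto

lemma spinsD: "\<alpha> \<in> spins V \<Longrightarrow> v \<in> V \<Longrightarrow> \<alpha> v = -1 \<or> \<alpha> v = 1"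
  unfolding spins_def by (auto dest!: PiE_mem)

lemma coord_prob_eq_prod:
  assumes "simple_graph V E" and spin: "\<And>v. v \<in> V \<Longrightarrow> \<alpha> v = -1 \<or> \<alpha> v = 1"
  shows "coord_prob E \<rho> \<alpha> = 1/2 * (\<Prod>e\<in>E. 1/2 * (1 + \<rho> * (\<Prod>v\<in>e. real_of_int (\<alpha> v))))"
proof -
  have "finite E"
    using assms(1) unfolding simple_graph_def by (auto intro: finite_subset[of E "Pow V"])
  let ?agree = "\<lambda>e. \<forall>u\<in>e. \<forall>v\<in>e. \<alpha> u = \<alpha> v"
  have "(\<Prod>e\<in>E. 1/2 * (1 + \<rho> * (\<Prod>v\<in>e. real_of_int (\<alpha> v))))
      = (\<Prod>e\<in>E. if ?agree e then 1/2 + 1/2 * \<rho> else 1/2 - 1/2 * \<rho>)"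
  proof (rule prod.cong)
    fix e assume "e \<in> E"
    then have "e \<subseteq> V" "card e = 2" using assms(1) by (auto simp: simple_graph_def)
    then obtain u v where e: "e = {u, v}" "u \<noteq> v" and "u \<in> V" "v \<in> V"
      by (auto simp: card_2_iff)
    from spin[OF \<open>u \<in> V\<close>] spin[OF \<open>v \<in> V\<close>]
    show "1/2 * (1 + \<rho> * (\<Prod>v\<in>e. real_of_int (\<alpha> v)))
        = (if ?agree e then 1/2 + 1/2 * \<rho> else 1/2 - 1/2 * \<rho>)"
      by (elim disjE) (simp_all add: e field_simps)
  qed simp
  also have "\<dots> = (1/2 + 1/2 * \<rho>) ^ agreements E \<alpha> * (1/2 - 1/2 * \<rho>) ^ disagreements E \<alpha>"
    unfolding agreements_def disagreements_def
    by (subst prod.If_cases[OF \<open>finite E\<close>]) (simp add: Int_def Collect_neg_eq[symmetric])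
  finally show ?thesis
    by (simp add: coord_prob_def)
qed

lemma coord_prob_nonneg: "0 \<le> \<rho> \<Longrightarrow> \<rho> \<le> 1 \<Longrightarrow> 0 \<le> coord_prob E \<rho> \<alpha>"
  by (simp add: coord_prob_def)

lemma coord_prob_uminus:
  "coord_prob E \<rho> (\<lambda>v. - \<alpha> v) = coord_prob E \<rho> \<alpha>"
  by (simp add: coord_prob_def agreements_def disagreements_def)

lemma coord_prob_cong:
  assumes "simple_graph V E" "\<And>v. v \<in> V \<Longrightarrow> \<alpha> v = \<beta> v"
  shows "coord_prob E \<rho> \<alpha> = coord_prob E \<rho> \<beta>"
proof -
  have eq: "(\<forall>u\<in>e. \<forall>v\<in>e. \<alpha> u = \<alpha> v) \<longleftrightarrow> (\<forall>u\<in>e. \<forall>v\<in>e. \<beta> u = \<beta> v)"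
    if "e \<in> E" for e
  proof -
    have "e \<subseteq> V" using assms(1) that by (simp add: simple_graph_def)
    then show ?thesis by (intro ball_cong refl) (simp add: assms(2) subset_iff)
  qed
  then have "{e \<in> E. \<forall>u\<in>e. \<forall>v\<in>e. \<alpha> u = \<alpha> v} = {e \<in> E. \<forall>u\<in>e. \<forall>v\<in>e. \<beta> u = \<beta> v}"
    and "{e \<in> E. \<exists>u\<in>e. \<exists>v\<in>e. \<alpha> u \<noteq> \<alpha> v} = {e \<in> E. \<exists>u\<in>e. \<exists>v\<in>e. \<beta> u \<noteq> \<beta> v}"
    by blast+
  then show ?thesis
    by (simp only: coord_prob_def agreements_def disagreements_def)
qed

section \<open>Nonnegative moments\<close>

text \<open>Monomials carry arbitrary exponents, although on spins only their parity counts: then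
  multiplying by another spin just increments an exponent.\<close>

lemma sum_monomial_nonneg:
  assumes "finite V"
  shows "0 \<le> (\<Sum>\<alpha>\<in>spins V. \<Prod>v\<in>V. real_of_int (\<alpha> v) ^ m v)"
proof -
  have "(\<Sum>\<alpha>\<in>spins V. \<Prod>v\<in>V. real_of_int (\<alpha> v) ^ m v)
      = (\<Prod>v\<in>V. \<Sum>b\<in>{-1, 1}. real_of_int b ^ m v)"
    unfolding spins_def by (rule prod_sum_PiE[symmetric]) (use assms in auto)
  also have "\<dots> \<ge> 0"
    by (rule prod_nonneg) (auto simp: minus_one_power_iff)
  finally show ?thesis .
qed

text \<open>Griffiths' first inequality: expanding the product over the edges, every term is a nonnegative
  multiple of a sum of a monomial over all spin configurations.\<close>

lemma ferromagnetic_moment_nonneg: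
  assumes "finite E" "finite V" "\<And>e. e \<in> E \<Longrightarrow> e \<subseteq> V" "0 \<le> \<rho>"
  shows "0 \<le> (\<Sum>\<alpha>\<in>spins V. (\<Prod>v\<in>V. real_of_int (\<alpha> v) ^ m v)
                 * (\<Prod>e\<in>E. 1 + \<rho> * (\<Prod>v\<in>e. real_of_int (\<alpha> v))))"
  using assms
proof (induction E arbitrary: m rule: finite_induct)
  case empty
  then show ?case using sum_monomial_nonneg by simp
next
  case (insert e E)
  let ?mon = "\<lambda>m \<alpha>. \<Prod>v\<in>V. real_of_int (\<alpha> v) ^ m v"
  let ?w = "\<lambda>\<alpha>. \<Prod>e\<in>E. 1 + \<rho> * (\<Prod>v\<in>e. real_of_int (\<alpha> v))"
  let ?m' = "\<lambda>v. m v + of_bool (v \<in> e)"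
  have edge: "?mon m \<alpha> * (\<Prod>v\<in>e. real_of_int (\<alpha> v)) = ?mon ?m' \<alpha>" for \<alpha> :: "'a \<Rightarrow> int"
  proof -
    have "V \<inter> e = e" using insert.prems(2)[of e] by auto
    then have "(\<Prod>v\<in>e. real_of_int (\<alpha> v)) = (\<Prod>v\<in>V. real_of_int (\<alpha> v) ^ of_bool (v \<in> e))"
      using prod.inter_restrict[OF \<open>finite V\<close>, of "\<lambda>v. real_of_int (\<alpha> v)" e]
      by (simp add: if_distrib of_bool_def cong: if_cong)
    then show ?thesis by (simp add: power_add prod.distrib)
  qed
  have "(\<Sum>\<alpha>\<in>spins V. ?mon m \<alpha> * (\<Prod>e\<in>insert e E. 1 + \<rho> * (\<Prod>v\<in>e. real_of_int (\<alpha> v))))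
      = (\<Sum>\<alpha>\<in>spins V. ?mon m \<alpha> * ?w \<alpha>) + \<rho> * (\<Sum>\<alpha>\<in>spins V. ?mon ?m' \<alpha> * ?w \<alpha>)"
    using insert.hyps
    by (simp add: edge[symmetric] sum_distrib_left sum.distrib[symmetric] algebra_simps)
  then show ?case
    using insert.IH[of m] insert.IH[of ?m'] insert.prems by simp
qed

lemma coord_prob_moment_nonneg:
  assumes "simple_graph V E" "0 \<le> \<rho>"
  shows "0 \<le> (\<Sum>\<alpha>\<in>spins V. coord_prob E \<rho> \<alpha> * (\<Prod>v\<in>V. real_of_int (\<alpha> v) ^ m v))"
proof -
  have fin: "finite V" "finite E" and sub: "\<And>e. e \<in> E \<Longrightarrow> e \<subseteq> V"
    using assms unfolding simple_graph_def by (auto intro: finite_subset[of E "Pow V"])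
  have "(\<Sum>\<alpha>\<in>spins V. coord_prob E \<rho> \<alpha> * (\<Prod>v\<in>V. real_of_int (\<alpha> v) ^ m v))
      = 1/2 * (1/2) ^ card E * (\<Sum>\<alpha>\<in>spins V. (\<Prod>v\<in>V. real_of_int (\<alpha> v) ^ m v)
                 * (\<Prod>e\<in>E. 1 + \<rho> * (\<Prod>v\<in>e. real_of_int (\<alpha> v))))"
    unfolding sum_distrib_left
  proof (rule sum.cong)
    fix \<alpha> :: "'a \<Rightarrow> int" assume "\<alpha> \<in> spins V"
    then have "coord_prob E \<rho> \<alpha> = 1/2 * (\<Prod>e\<in>E. 1/2 * (1 + \<rho> * (\<Prod>v\<in>e. real_of_int (\<alpha> v))))"
      by (intro coord_prob_eq_prod[OF assms(1)] spinsD)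
    also have "\<dots> = 1/2 * ((1/2) ^ card E * (\<Prod>e\<in>E. 1 + \<rho> * (\<Prod>v\<in>e. real_of_int (\<alpha> v))))"
      by (simp only: prod.distrib prod_constant)
    finally show "coord_prob E \<rho> \<alpha> * (\<Prod>v\<in>V. real_of_int (\<alpha> v) ^ m v)
      = 1/2 * (1/2) ^ card E * ((\<Prod>v\<in>V. real_of_int (\<alpha> v) ^ m v)
                 * (\<Prod>e\<in>E. 1 + \<rho> * (\<Prod>v\<in>e. real_of_int (\<alpha> v))))"
      by (simp only: mult_ac)
  qed simp
  also have "\<dots> \<ge> 0"
    by (intro mult_nonneg_nonneg ferromagnetic_moment_nonneg[OF fin(2,1) sub assms(2)]) auto
  finally show ?thesis .
qed

text \<open>Expanding the product over \<open>S\<close> gives moments with coefficients that are products of \<open>a v\<close>'s and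
  \<open>b v\<close>'s; the moments and the \<open>a v\<close> are nonnegative, so absolute values may be put on the \<open>b v\<close>. The
  additional monomial lets the induction on \<open>S\<close> absorb the spins of the factors already expanded.\<close>

lemma abs_sum_affine_prod_le:
  fixes p :: "('v \<Rightarrow> int) \<Rightarrow> real" and a b :: "'v \<Rightarrow> real"
  assumes "finite V" "finite S" "S \<subseteq> V"
    and moment: "\<And>m. 0 \<le> (\<Sum>\<alpha>\<in>spins V. p \<alpha> * (\<Prod>v\<in>V. real_of_int (\<alpha> v) ^ m v))"
    and a: "\<And>v. v \<in> S \<Longrightarrow> 0 \<le> a v"
  shows "\<bar>\<Sum>\<alpha>\<in>spins V. p \<alpha> * (\<Prod>v\<in>V. real_of_int (\<alpha> v) ^ m v) * (\<Prod>v\<in>S. a v + b v * \<alpha> v)\<bar>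
      \<le> (\<Sum>\<alpha>\<in>spins V. p \<alpha> * (\<Prod>v\<in>V. real_of_int (\<alpha> v) ^ m v) * (\<Prod>v\<in>S. a v + \<bar>b v\<bar> * \<alpha> v))"
  using \<open>finite S\<close> \<open>S \<subseteq> V\<close> a
proof (induction S arbitrary: m rule: finite_induct)
  case empty
  then show ?case using moment by simp
next
  case (insert u S)
  let ?F = "\<lambda>m b. \<Sum>\<alpha>\<in>spins V. p \<alpha> * (\<Prod>v\<in>V. real_of_int (\<alpha> v) ^ m v)
                      * (\<Prod>v\<in>S. a v + b v * real_of_int (\<alpha> v))"
  let ?m' = "m(u := Suc (m u))"
  have IH: "\<bar>?F m b\<bar> \<le> ?F m (\<lambda>v. \<bar>b v\<bar>)" for m
    using insert.prems by (intro insert.IH) auto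
  have u: "u \<in> V" "0 \<le> a u" using insert.prems by auto
  have shift: "(\<Prod>v\<in>V. real_of_int (\<alpha> v) ^ ?m' v) = \<alpha> u * (\<Prod>v\<in>V. real_of_int (\<alpha> v) ^ m v)"
    for \<alpha> :: "'v \<Rightarrow> int"
    using \<open>finite V\<close> u(1) by (simp add: prod.remove[of V u])
  have split: "(\<Sum>\<alpha>\<in>spins V. p \<alpha> * (\<Prod>v\<in>V. real_of_int (\<alpha> v) ^ m v)
          * (\<Prod>v\<in>insert u S. a v + c v * real_of_int (\<alpha> v)))
      = a u * ?F m c + c u * ?F ?m' c" for c
    unfolding shift sum_distrib_left sum.distrib[symmetric]
    using insert.hyps by (intro sum.cong refl) (simp add: distrib_left distrib_right mult_ac)
  have "\<bar>a u * ?F m b + b u * ?F ?m' b\<bar> \<le> a u * \<bar>?F m b\<bar> + \<bar>b u\<bar> * \<bar>?F ?m' b\<bar>"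
    using u(2) by (intro order_trans[OF abs_triangle_ineq]) (simp add: abs_mult)
  also have "\<dots> \<le> a u * ?F m (\<lambda>v. \<bar>b v\<bar>) + \<bar>b u\<bar> * ?F ?m' (\<lambda>v. \<bar>b v\<bar>)"
    by (intro add_mono mult_left_mono IH u(2) abs_ge_zero)
  finally show ?case unfolding split .
qed

text \<open>The congruence hypothesis makes up for pointwise negation leaving the extensional functions:
  it changes the default value outside \<open>V\<close>.\<close>

lemma sum_spins_uminus:
  fixes F :: "('v \<Rightarrow> int) \<Rightarrow> real"
  assumes cong: "\<And>\<alpha> \<beta>. (\<And>v. v \<in> V \<Longrightarrow> \<alpha> v = \<beta> v) \<Longrightarrow> F \<alpha> = F \<beta>"
  shows "(\<Sum>\<alpha>\<in>spins V. F (\<lambda>v. - \<alpha> v)) = (\<Sum>\<alpha>\<in>spins V. F \<alpha>)"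
proof (rule sum.reindex_bij_witness[of _ "\<lambda>\<alpha>. \<lambda>v\<in>V. - \<alpha> v" "\<lambda>\<alpha>. \<lambda>v\<in>V. - \<alpha> v"])
  fix \<alpha> :: "'v \<Rightarrow> int" assume \<alpha>: "\<alpha> \<in> spins V"
  have "- \<alpha> v \<in> {-1, 1}" if "v \<in> V" for v
    using spinsD[OF \<alpha> that] by (elim disjE) simp_all
  then show "(\<lambda>v\<in>V. - \<alpha> v) \<in> spins V" "(\<lambda>v\<in>V. - \<alpha> v) \<in> spins V"
    unfolding spins_def restrict_PiE_iff by blast+
  have "\<alpha> v = undefined" if "v \<notin> V" for v
    using \<alpha> that unfolding spins_def by (rule PiE_arb)
  then show "(\<lambda>v\<in>V. - (\<lambda>v\<in>V. - \<alpha> v) v) = \<alpha>" "(\<lambda>v\<in>V. - (\<lambda>v\<in>V. - \<alpha> v) v) = \<alpha>"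
    by (auto simp: fun_eq_iff restrict_def)
  show "F (\<lambda>v\<in>V. - \<alpha> v) = F (\<lambda>v. - \<alpha> v)"
    by (rule cong) simp
qed

text \<open>The signed version for \<open>c = -1\<close> follows from the one for \<open>c = 1\<close> by flipping all spins.\<close>

lemma coord_prob_affine_prod_le:
  fixes a b :: "'v \<Rightarrow> real"
  assumes G: "simple_graph V E" and "0 \<le> \<rho>" "S \<subseteq> V"
    and a: "\<And>v. v \<in> S \<Longrightarrow> 0 \<le> a v" and c: "c = 1 \<or> c = -1"
  shows "(\<Sum>\<alpha>\<in>spins V. coord_prob E \<rho> \<alpha> * (\<Prod>v\<in>S. a v + b v * \<alpha> v))
      \<le> (\<Sum>\<alpha>\<in>spins V. coord_prob E \<rho> \<alpha> * (\<Prod>v\<in>S. a v + c * \<bar>b v\<bar> * \<alpha> v))"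
proof -
  let ?F = "\<lambda>\<alpha>. coord_prob E \<rho> \<alpha> * (\<Prod>v\<in>S. a v + \<bar>b v\<bar> * real_of_int (\<alpha> v))"
  have "finite V" using G by (simp add: simple_graph_def)
  with \<open>S \<subseteq> V\<close> have "finite S" using finite_subset by blast
  let ?one = "\<lambda>\<alpha>. \<Prod>v\<in>V. real_of_int (\<alpha> v) ^ 0"
  have "\<bar>\<Sum>\<alpha>\<in>spins V. coord_prob E \<rho> \<alpha> * ?one \<alpha> * (\<Prod>v\<in>S. a v + b v * \<alpha> v)\<bar>
      \<le> (\<Sum>\<alpha>\<in>spins V. coord_prob E \<rho> \<alpha> * ?one \<alpha> * (\<Prod>v\<in>S. a v + \<bar>b v\<bar> * \<alpha> v))"
    by (rule abs_sum_affine_prod_le[OF \<open>finite V\<close> \<open>finite S\<close> \<open>S \<subseteq> V\<close>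
          coord_prob_moment_nonneg[OF G \<open>0 \<le> \<rho>\<close>] a])
  then have "(\<Sum>\<alpha>\<in>spins V. coord_prob E \<rho> \<alpha> * (\<Prod>v\<in>S. a v + b v * \<alpha> v)) \<le> (\<Sum>\<alpha>\<in>spins V. ?F \<alpha>)"
    by (simp only: power_0 prod.neutral_const mult_1_right abs_le_iff)
  moreover have "(\<Sum>\<alpha>\<in>spins V. ?F (\<lambda>v. - \<alpha> v)) = (\<Sum>\<alpha>\<in>spins V. ?F \<alpha>)"
  proof (rule sum_spins_uminus)
    fix \<alpha> \<beta> :: "'v \<Rightarrow> int" assume "\<And>v. v \<in> V \<Longrightarrow> \<alpha> v = \<beta> v"
    then show "?F \<alpha> = ?F \<beta>"
      using coord_prob_cong[OF G, of \<alpha> \<beta>] \<open>S \<subseteq> V\<close>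
      by (intro arg_cong2[where f = "(*)"] prod.cong) auto
  qed
  ultimately show ?thesis
    using c by (auto simp: coord_prob_uminus)
qed

section \<open>Sorting functions of one bit\<close>

definition sort_bit :: "(int \<Rightarrow> int) \<Rightarrow> int \<Rightarrow> int" where
  "sort_bit h b = (if b = 1 then max (h (-1)) (h 1) else min (h (-1)) (h 1))"

text \<open>A function of one bit is affine, and so is the indicator \<open>(1 + c * h b) / 2\<close> of \<open>h b = c\<close>.\<close>

lemma of_bool_eq_affine:
  assumes "h (-1) = -1 \<or> h (-1) = 1" "h 1 = -1 \<or> h 1 = 1" "b = -1 \<or> b = 1" "c = 1 \<or> c = -1"
  shows "of_bool (h b = c)
       = (1/2 + of_int (c * (h 1 + h (-1))) / 4) + of_int (c * (h 1 - h (-1))) / 4 * real_of_int b"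
  using assms by (elim disjE) simp_all

lemma of_bool_Ball: "finite S \<Longrightarrow> of_bool (\<forall>v\<in>S. P v) = (\<Prod>v\<in>S. of_bool (P v) :: real)"
  by (induction S rule: finite_induct) auto

text \<open>In the affine form of the indicator of \<open>h b = c\<close>, sorting \<open>h\<close> keeps the constant term, which
  contains \<open>h 1 + h (-1)\<close>, and turns the coefficient of \<open>b\<close>, which contains \<open>h 1 - h (-1)\<close>, into \<open>c\<close>
  times its absolute value.\<close>

lemma coord_prob_all_eq_sort_bit:
  fixes g :: "'v \<Rightarrow> int \<Rightarrow> int"
  assumes G: "simple_graph V E" and "0 \<le> \<rho>" "S \<subseteq> V"
    and g: "\<And>v b. v \<in> S \<Longrightarrow> b = -1 \<or> b = 1 \<Longrightarrow> g v b = -1 \<or> g v b = 1"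
    and c: "c = 1 \<or> c = -1"
  shows "(\<Sum>\<alpha>\<in>spins V. coord_prob E \<rho> \<alpha> * of_bool (\<forall>v\<in>S. g v (\<alpha> v) = c))
      \<le> (\<Sum>\<alpha>\<in>spins V. coord_prob E \<rho> \<alpha> * of_bool (\<forall>v\<in>S. sort_bit (g v) (\<alpha> v) = c))"
proof -
  let ?a = "\<lambda>v. 1/2 + of_int (c * (g v 1 + g v (-1))) / 4 :: real"
  let ?b = "\<lambda>v. of_int (c * (g v 1 - g v (-1))) / 4 :: real"
  have "finite S" using G \<open>S \<subseteq> V\<close> by (auto simp: simple_graph_def intro: finite_subset)
  have a: "0 \<le> ?a v" if "v \<in> S" for v
    using g[OF that, of 1] g[OF that, of "-1"] c by auto
  have before: "of_bool (\<forall>v\<in>S. g v (\<alpha> v) = c) = (\<Prod>v\<in>S. ?a v + ?b v * \<alpha> v)"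
    if "\<alpha> \<in> spins V" for \<alpha>
    unfolding of_bool_Ball[OF \<open>finite S\<close>]
    using g spinsD[OF that] \<open>S \<subseteq> V\<close> c by (intro prod.cong of_bool_eq_affine) auto
  have after: "of_bool (\<forall>v\<in>S. sort_bit (g v) (\<alpha> v) = c)
             = (\<Prod>v\<in>S. ?a v + real_of_int c * \<bar>?b v\<bar> * \<alpha> v)"
    if "\<alpha> \<in> spins V" for \<alpha>
    unfolding of_bool_Ball[OF \<open>finite S\<close>]
  proof (rule prod.cong)
    fix v assume v: "v \<in> S"
    then have gv: "g v 1 = -1 \<or> g v 1 = 1" "g v (-1) = -1 \<or> g v (-1) = 1" and "v \<in> V"
      using g \<open>S \<subseteq> V\<close> by auto
    with spinsD[OF that \<open>v \<in> V\<close>] c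
    show "of_bool (sort_bit (g v) (\<alpha> v) = c) = ?a v + real_of_int c * \<bar>?b v\<bar> * \<alpha> v"
      by (elim disjE) (simp_all add: sort_bit_def)
  qed simp
  have "(\<Sum>\<alpha>\<in>spins V. coord_prob E \<rho> \<alpha> * of_bool (\<forall>v\<in>S. g v (\<alpha> v) = c))
      = (\<Sum>\<alpha>\<in>spins V. coord_prob E \<rho> \<alpha> * (\<Prod>v\<in>S. ?a v + ?b v * \<alpha> v))"
    by (intro sum.cong refl) (simp only: before)
  also have "\<dots> \<le> (\<Sum>\<alpha>\<in>spins V. coord_prob E \<rho> \<alpha> * (\<Prod>v\<in>S. ?a v + real_of_int c * \<bar>?b v\<bar> * \<alpha> v))"
    by (intro coord_prob_affine_prod_le[OF G \<open>0 \<le> \<rho>\<close> \<open>S \<subseteq> V\<close>] a) (use c in auto)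
  also have "\<dots> = (\<Sum>\<alpha>\<in>spins V. coord_prob E \<rho> \<alpha> * of_bool (\<forall>v\<in>S. sort_bit (g v) (\<alpha> v) = c))"
    by (intro sum.cong refl) (simp only: after)
  finally show ?thesis .
qed

text \<open>Agreement is the disjoint union of agreement on \<open>1\<close> and agreement on \<open>-1\<close>, except
  when there are no players, where both sides are the same.\<close>

lemma coord_prob_agree_sort_bit:
  fixes g :: "'v \<Rightarrow> int \<Rightarrow> int"
  assumes G: "simple_graph V E" and "0 \<le> \<rho>" "S \<subseteq> V"
    and g: "\<And>v b. v \<in> S \<Longrightarrow> b = -1 \<or> b = 1 \<Longrightarrow> g v b = -1 \<or> g v b = 1"
  shows "(\<Sum>\<alpha>\<in>spins V. coord_prob E \<rho> \<alpha> * of_bool (\<forall>u\<in>S. \<forall>v\<in>S. g u (\<alpha> u) = g v (\<alpha> v)))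
      \<le> (\<Sum>\<alpha>\<in>spins V. coord_prob E \<rho> \<alpha>
            * of_bool (\<forall>u\<in>S. \<forall>v\<in>S. sort_bit (g u) (\<alpha> u) = sort_bit (g v) (\<alpha> v)))"
proof (cases "S = {}")
  case False
  then obtain s where s: "s \<in> S" by auto
  have split: "of_bool (\<forall>u\<in>S. \<forall>v\<in>S. h u (\<alpha> u) = h v (\<alpha> v))
      = of_bool (\<forall>v\<in>S. h v (\<alpha> v) = 1) + (of_bool (\<forall>v\<in>S. h v (\<alpha> v) = -1) :: real)"
    if h: "\<And>v b. v \<in> S \<Longrightarrow> b = -1 \<or> b = 1 \<Longrightarrow> h v b = -1 \<or> h v b = 1"
      and \<alpha>: "\<alpha> \<in> spins V" for h :: "'v \<Rightarrow> int \<Rightarrow> int" and \<alpha>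
  proof -
    have "h s (\<alpha> s) = -1 \<or> h s (\<alpha> s) = 1" using h s spinsD[OF \<alpha>] \<open>S \<subseteq> V\<close> by auto
    then have "(\<forall>u\<in>S. \<forall>v\<in>S. h u (\<alpha> u) = h v (\<alpha> v))
        \<longleftrightarrow> (\<forall>v\<in>S. h v (\<alpha> v) = 1) \<or> (\<forall>v\<in>S. h v (\<alpha> v) = -1)"
      using s by metis
    moreover have "\<not> ((\<forall>v\<in>S. h v (\<alpha> v) = 1) \<and> (\<forall>v\<in>S. h v (\<alpha> v) = -1))"
      using s by force
    moreover have "of_bool (P \<or> Q) = of_bool P + (of_bool Q :: real)" if "\<not> (P \<and> Q)" for P Q
      using that by auto
    ultimately show ?thesis by (simp only: not_False_eq_True)
  qed
  have sorted: "sort_bit (g v) b = -1 \<or> sort_bit (g v) b = 1" if "v \<in> S" for v b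
    using g[OF that, of 1] g[OF that, of "-1"] by (auto simp: sort_bit_def)
  let ?P = "\<lambda>h c. \<Sum>\<alpha>\<in>spins V. coord_prob E \<rho> \<alpha> * of_bool (\<forall>v\<in>S. h v (\<alpha> v) = c)"
  have total: "(\<Sum>\<alpha>\<in>spins V. coord_prob E \<rho> \<alpha> * of_bool (\<forall>u\<in>S. \<forall>v\<in>S. h u (\<alpha> u) = h v (\<alpha> v)))
      = ?P h 1 + ?P h (-1)"
    if h: "\<And>v b. v \<in> S \<Longrightarrow> b = -1 \<or> b = 1 \<Longrightarrow> h v b = -1 \<or> h v b = 1" for h :: "'v \<Rightarrow> int \<Rightarrow> int"
    unfolding sum.distrib[symmetric] distrib_left[symmetric]
    by (intro sum.cong refl arg_cong2[where f="(*)"] split h)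
  have "?P g 1 + ?P g (-1) \<le> ?P (\<lambda>v. sort_bit (g v)) 1 + ?P (\<lambda>v. sort_bit (g v)) (-1)"
    by (intro add_mono coord_prob_all_eq_sort_bit[OF G \<open>0 \<le> \<rho>\<close> \<open>S \<subseteq> V\<close>] g) simp_all
  then show ?thesis
    by (subst (1 2) total) (use g sorted in blast)+
qed simp

section \<open>Separating one coordinate of the strings\<close>

lemma finite_cube: "finite (cube n)"
  unfolding cube_def by (rule finite_PiE) auto

lemma cube_upd: "x \<in> cube n \<Longrightarrow> i < n \<Longrightarrow> b = -1 \<or> b = 1 \<Longrightarrow> x(i := b) \<in> cube n"
  unfolding cube_def PiE_iff by (auto simp: extensional_def)

lemma cubeD: "x \<in> cube n \<Longrightarrow> i < n \<Longrightarrow> x i = -1 \<or> x i = 1"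
  unfolding cube_def by (auto dest!: PiE_mem)

definition set_coord :: "'v set \<Rightarrow> nat \<Rightarrow> ('v \<Rightarrow> int) \<Rightarrow> ('v \<Rightarrow> nat \<Rightarrow> int) \<Rightarrow> 'v \<Rightarrow> nat \<Rightarrow> int" where
  "set_coord V i \<alpha> Y = (\<lambda>v\<in>V. (Y v)(i := \<alpha> v))"

text \<open>Settings of all coordinates but \<open>i\<close> are represented by the families of strings whose
  coordinate \<open>i\<close> is constantly \<open>1\<close>.\<close>

lemma sum_strings_split:
  fixes F :: "('v \<Rightarrow> nat \<Rightarrow> int) \<Rightarrow> real"
  assumes "i < n"
  shows "(\<Sum>X\<in>V \<rightarrow>\<^sub>E cube n. F X)
    = (\<Sum>Y | Y \<in> V \<rightarrow>\<^sub>E cube n \<and> (\<forall>v\<in>V. Y v i = 1). \<Sum>\<alpha>\<in>spins V. F (set_coord V i \<alpha> Y))"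
proof -
  let ?\<Omega> = "V \<rightarrow>\<^sub>E cube n"
  have set_in: "set_coord V i \<alpha> Y \<in> ?\<Omega>"
    if "Y \<in> ?\<Omega>" "\<And>v. v \<in> V \<Longrightarrow> \<alpha> v = -1 \<or> \<alpha> v = 1" for \<alpha> Y
    using that \<open>i < n\<close> by (auto simp: set_coord_def intro!: cube_upd)
  have "(\<Sum>X\<in>?\<Omega>. F X) = (\<Sum>(Y, \<alpha>)\<in>{Y \<in> ?\<Omega>. \<forall>v\<in>V. Y v i = 1} \<times> spins V. F (set_coord V i \<alpha> Y))"
  proof (rule sum.reindex_bij_witness[of _ "\<lambda>(Y, \<alpha>). set_coord V i \<alpha> Y"
        "\<lambda>X. (set_coord V i (\<lambda>_. 1) X, \<lambda>v\<in>V. X v i)"])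
    fix X assume X: "X \<in> ?\<Omega>"
    show restore: "(case (set_coord V i (\<lambda>_. 1) X, \<lambda>v\<in>V. X v i) of (Y, \<alpha>) \<Rightarrow> set_coord V i \<alpha> Y) = X"
      using X by (simp add: set_coord_def fun_eq_iff PiE_iff extensional_def)
    then show "(case (set_coord V i (\<lambda>_. 1) X, \<lambda>v\<in>V. X v i) of (Y, \<alpha>) \<Rightarrow> F (set_coord V i \<alpha> Y)) = F X"
      by simp
    show "(set_coord V i (\<lambda>_. 1) X, \<lambda>v\<in>V. X v i) \<in> {Y \<in> ?\<Omega>. \<forall>v\<in>V. Y v i = 1} \<times> spins V"
    proof -
      have "X v i \<in> {-1, 1}" if "v \<in> V" for v
        using cubeD[OF PiE_mem[OF X that] \<open>i < n\<close>] by simp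
      then have "(\<lambda>v\<in>V. X v i) \<in> spins V"
        unfolding spins_def restrict_PiE_iff by blast
      then show ?thesis
        using set_in[OF X, of "\<lambda>_. 1"] by (simp add: set_coord_def)
    qed
  next
    fix p assume "p \<in> {Y \<in> ?\<Omega>. \<forall>v\<in>V. Y v i = 1} \<times> spins V"
    then obtain Y \<alpha> where p: "p = (Y, \<alpha>)" and Y: "Y \<in> ?\<Omega>" "\<forall>v\<in>V. Y v i = 1" and \<alpha>: "\<alpha> \<in> spins V"
      by auto
    have "set_coord V i (\<lambda>_. 1) (set_coord V i \<alpha> Y) = Y"
    proof
      fix v
      show "set_coord V i (\<lambda>_. 1) (set_coord V i \<alpha> Y) v = Y v"
        using Y PiE_arb[OF Y(1), of v] by (cases "v \<in> V") (simp_all add: set_coord_def fun_upd_idem)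
    qed
    moreover have "(\<lambda>v\<in>V. set_coord V i \<alpha> Y v i) = \<alpha>"
      using \<alpha> by (simp add: set_coord_def spins_def fun_eq_iff PiE_iff extensional_def)
    ultimately show "(set_coord V i (\<lambda>_. 1) (case p of (Y, \<alpha>) \<Rightarrow> set_coord V i \<alpha> Y),
        \<lambda>v\<in>V. (case p of (Y, \<alpha>) \<Rightarrow> set_coord V i \<alpha> Y) v i) = p"
      by (simp add: p)
    show "(case p of (Y, \<alpha>) \<Rightarrow> set_coord V i \<alpha> Y) \<in> ?\<Omega>"
      using set_in[OF Y(1)] spinsD[OF \<alpha>] by (simp add: p)
  qed
  then show ?thesis by (simp add: sum.cartesian_product)
qed

lemma agree_prob_eq_sum:
  assumes "finite V" "0 \<le> \<rho>" "\<rho> \<le> 1"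
  shows "agree_prob V E \<rho> n S f
    = (\<Sum>X\<in>V \<rightarrow>\<^sub>E cube n. (\<Prod>i<n. coord_prob E \<rho> (\<lambda>v. X v i))
          * of_bool (\<forall>u\<in>S. \<forall>v\<in>S. f u (X u) = f v (X v)))"
proof -
  have fin: "finite (V \<rightarrow>\<^sub>E cube n)" using assms(1) finite_cube by (intro finite_PiE)
  let ?w = "\<lambda>X. \<Prod>i<n. coord_prob E \<rho> (\<lambda>v. X v i)"
  let ?A = "{X \<in> V \<rightarrow>\<^sub>E cube n. \<forall>u\<in>S. \<forall>v\<in>S. f u (X u) = f v (X v)}"
  have w: "0 \<le> ?w X" for X :: "'a \<Rightarrow> nat \<Rightarrow> int"
    by (intro prod_nonneg ballI coord_prob_nonneg assms)
  have "agree_prob V E \<rho> n S f = enn2real (\<Sum>X\<in>?A. ennreal (?w X))"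
    unfolding agree_prob_def nicd_measure_def space_point_measure measure_def
    by (subst emeasure_point_measure_finite[OF fin]) simp_all
  also have "\<dots> = (\<Sum>X\<in>?A. ?w X)"
    by (simp only: sum_ennreal[OF w] enn2real_ennreal sum_nonneg[OF w])
  also have "\<dots> = (\<Sum>X\<in>V \<rightarrow>\<^sub>E cube n. ?w X * of_bool (\<forall>u\<in>S. \<forall>v\<in>S. f u (X u) = f v (X v)))"
    by (simp add: sum.inter_filter[OF fin, symmetric] of_bool_def if_distrib cong: if_cong)
  finally show ?thesis .
qed

section \<open>Shifting a coordinate\<close>

definition up_shift :: "nat \<Rightarrow> ((nat \<Rightarrow> int) \<Rightarrow> int) \<Rightarrow> (nat \<Rightarrow> int) \<Rightarrow> int" where
  "up_shift i f x = sort_bit (\<lambda>b. f (x(i := b))) (x i)"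

text \<open>Given the coordinates other than \<open>i\<close>, the bits in coordinate \<open>i\<close> follow the Ising law, and
  shifting \<open>f v\<close> amounts to sorting the function of one bit that \<open>f v\<close> has become.\<close>

lemma agree_prob_up_shift:
  assumes G: "simple_graph V E" and \<rho>: "0 \<le> \<rho>" "\<rho> \<le> 1" and "S \<subseteq> V" "i < n"
    and f: "\<And>v x. v \<in> S \<Longrightarrow> x \<in> cube n \<Longrightarrow> f v x = -1 \<or> f v x = 1"
  shows "agree_prob V E \<rho> n S f \<le> agree_prob V E \<rho> n S (\<lambda>v. up_shift i (f v))"
proof -
  have "finite V" using G by (simp add: simple_graph_def)
  let ?\<Omega> = "{Y. Y \<in> V \<rightarrow>\<^sub>E cube n \<and> (\<forall>v\<in>V. Y v i = 1)}"
  let ?rest = "\<lambda>Y. \<Prod>j\<in>{..<n} - {i}. coord_prob E \<rho> (\<lambda>v. Y v j)"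
  let ?agree = "\<lambda>h \<alpha>. of_bool (\<forall>u\<in>S. \<forall>v\<in>S. h u (\<alpha> u) = h v (\<alpha> v)) :: real"
  let ?g = "\<lambda>Y v b. f v ((Y v)(i := b))"
  have weight: "(\<Prod>j<n. coord_prob E \<rho> (\<lambda>v. set_coord V i \<alpha> Y v j))
      = ?rest Y * coord_prob E \<rho> \<alpha>" for \<alpha> Y
  proof -
    have "(\<Prod>j<n. coord_prob E \<rho> (\<lambda>v. set_coord V i \<alpha> Y v j))
        = coord_prob E \<rho> (\<lambda>v. set_coord V i \<alpha> Y v i)
          * (\<Prod>j\<in>{..<n} - {i}. coord_prob E \<rho> (\<lambda>v. set_coord V i \<alpha> Y v j))"
      using \<open>i < n\<close> by (simp add: prod.remove)
    also have "coord_prob E \<rho> (\<lambda>v. set_coord V i \<alpha> Y v i) = coord_prob E \<rho> \<alpha>"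
      by (rule coord_prob_cong[OF G]) (simp add: set_coord_def)
    also have "(\<Prod>j\<in>{..<n} - {i}. coord_prob E \<rho> (\<lambda>v. set_coord V i \<alpha> Y v j)) = ?rest Y"
      by (intro prod.cong coord_prob_cong[OF G]) (auto simp: set_coord_def)
    finally show ?thesis by (simp add: mult.commute)
  qed
  have split: "agree_prob V E \<rho> n S h
      = (\<Sum>Y\<in>?\<Omega>. ?rest Y * (\<Sum>\<alpha>\<in>spins V. coord_prob E \<rho> \<alpha>
            * ?agree (\<lambda>v b. h v ((Y v)(i := b))) \<alpha>))" for h
  proof -
    have "?agree h (set_coord V i \<alpha> Y) = ?agree (\<lambda>v b. h v ((Y v)(i := b))) \<alpha>" for \<alpha> Y
      using \<open>S \<subseteq> V\<close> by (intro arg_cong[where f=of_bool] ball_cong) (auto simp: set_coord_def subset_iff)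
    then show ?thesis
      unfolding agree_prob_eq_sum[OF \<open>finite V\<close> \<rho>] sum_strings_split[OF \<open>i < n\<close>]
      by (simp add: weight sum_distrib_left mult.assoc)
  qed
  have fibre: "(\<Sum>\<alpha>\<in>spins V. coord_prob E \<rho> \<alpha> * ?agree (?g Y) \<alpha>)
      \<le> (\<Sum>\<alpha>\<in>spins V. coord_prob E \<rho> \<alpha> * ?agree (\<lambda>v. sort_bit (?g Y v)) \<alpha>)"
    if "Y \<in> ?\<Omega>" for Y
  proof (rule coord_prob_agree_sort_bit[OF G \<rho>(1) \<open>S \<subseteq> V\<close>, of "?g Y"])
    fix v and b :: int assume "v \<in> S" "b = -1 \<or> b = 1"
    moreover from this have "Y v \<in> cube n" using that \<open>S \<subseteq> V\<close> by auto
    ultimately show "?g Y v b = -1 \<or> ?g Y v b = 1"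
      using \<open>i < n\<close> by (intro f cube_upd)
  qed
  have "agree_prob V E \<rho> n S f
      \<le> (\<Sum>Y\<in>?\<Omega>. ?rest Y * (\<Sum>\<alpha>\<in>spins V. coord_prob E \<rho> \<alpha> * ?agree (\<lambda>v. sort_bit (?g Y v)) \<alpha>))"
    unfolding split
    by (intro sum_mono mult_left_mono fibre prod_nonneg ballI coord_prob_nonneg \<rho>)
  also have "\<dots> = agree_prob V E \<rho> n S (\<lambda>v. up_shift i (f v))"
    unfolding split by (simp add: up_shift_def)
  finally show ?thesis .
qed

lemma sum_cube_flip:
  fixes F :: "(nat \<Rightarrow> int) \<Rightarrow> nat"
  assumes "i < n"
  shows "(\<Sum>x\<in>cube n. F (x(i := - x i))) = (\<Sum>x\<in>cube n. F x)"
proof (rule sum.reindex_bij_witness[of _ "\<lambda>x. x(i := - x i)" "\<lambda>x. x(i := - x i)"])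
  fix x :: "nat \<Rightarrow> int" assume x: "x \<in> cube n"
  show "x(i := - x i) \<in> cube n" "x(i := - x i) \<in> cube n"
    using x cubeD[OF x assms] assms by (auto intro!: cube_upd)
qed auto

text \<open>Shifting permutes the two values on each pair of strings that differ in coordinate \<open>i\<close> only;
  summing over such pairs counts every string twice.\<close>

lemma card_up_shift:
  assumes "i < n"
  shows "card {x \<in> cube n. up_shift i f x = b} = card {x \<in> cube n. f x = b}"
proof -
  let ?N = "\<lambda>h. \<Sum>x\<in>cube n. of_bool (h x = b) :: nat"
  have count: "card {x \<in> cube n. h x = b} = ?N h" for h
    using finite_cube by (simp add: sum.inter_filter[symmetric] of_bool_def)
  have pairs: "2 * ?N h = (\<Sum>x\<in>cube n. of_bool (h x = b) + of_bool (h (x(i := - x i)) = b))" for h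
    using sum_cube_flip[OF assms, of "\<lambda>x. of_bool (h x = b)"] by (simp add: sum.distrib)
  have "2 * ?N (up_shift i f) = 2 * ?N f"
    unfolding pairs
  proof (rule sum.cong)
    fix x :: "nat \<Rightarrow> int" assume "x \<in> cube n"
    then consider "x i = -1" | "x i = 1" using cubeD assms by blast
    then show "of_bool (up_shift i f x = b) + of_bool (up_shift i f (x(i := - x i)) = b)
        = (of_bool (f x = b) + of_bool (f (x(i := - x i)) = b) :: nat)"
    proof cases
      case 1
      then have "x = x(i := -1)" by auto
      with 1 show ?thesis by (auto simp: up_shift_def sort_bit_def max_def min_def)
    next
      case 2
      then have "x = x(i := 1)" by auto
      with 2 show ?thesis by (auto simp: up_shift_def sort_bit_def max_def min_def)
    qed
  qed simp
  then show ?thesis unfolding count by simp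
qed

lemma balanced_up_shift:
  assumes "balanced n f" "i < n"
  shows "balanced n (up_shift i f)"
proof -
  have "f x = -1 \<or> f x = 1" if "x \<in> cube n" for x
    using assms(1) that by (auto simp: balanced_def)
  then have "up_shift i f x \<in> {-1, 1}" if "x \<in> cube n" for x
    using cube_upd[OF that assms(2), of 1] cube_upd[OF that assms(2), of "-1"]
    by (simp add: up_shift_def sort_bit_def max_def min_def)
  then show ?thesis
    using assms by (simp add: balanced_def card_up_shift)
qed

section \<open>Monotonicity coordinate by coordinate\<close>

definition coord_monotone :: "nat \<Rightarrow> nat \<Rightarrow> ((nat \<Rightarrow> int) \<Rightarrow> int) \<Rightarrow> bool" where
  "coord_monotone n i f \<longleftrightarrow> (\<forall>x\<in>cube n. f (x(i := -1)) \<le> f (x(i := 1)))"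

lemma coord_monotone_up_shift: "coord_monotone n i (up_shift i f)"
  by (auto simp: coord_monotone_def up_shift_def sort_bit_def)

text \<open>The shifted value is a minimum or a maximum of two values of \<open>f\<close>, and both of them
  increase with coordinate \<open>j\<close>.\<close>

lemma coord_monotone_up_shift_other:
  assumes "coord_monotone n j f" "j \<noteq> i" "i < n"
  shows "coord_monotone n j (up_shift i f)"
  unfolding coord_monotone_def
proof
  fix x assume x: "x \<in> cube n"
  have "f (x(i := b, j := -1)) \<le> f (x(i := b, j := 1))" if "b = -1 \<or> b = 1" for b
    using assms(1) cube_upd[OF x \<open>i < n\<close> that] by (simp add: coord_monotone_def)
  from this[of 1] this[of "-1"] \<open>j \<noteq> i\<close>
  show "up_shift i f (x(j := -1)) \<le> up_shift i f (x(j := 1))"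
    by (auto simp: up_shift_def sort_bit_def fun_upd_twist[OF \<open>j \<noteq> i\<close>] intro: max.mono min.mono)
qed

lemma cube_monotoneI:
  assumes mono: "\<And>i. i < n \<Longrightarrow> coord_monotone n i f"
  shows "cube_monotone n f"
  unfolding cube_monotone_def
proof (rule monotone_onI)
  fix x y assume x: "x \<in> cube n" and y: "y \<in> cube n" and le: "\<forall>i<n. x i \<le> y i"
  (* A path from x to y that changes one coordinate at a time. *)
  let ?z = "\<lambda>k j. if j < k then y j else x j"
  have z: "?z k \<in> cube n" if "k \<le> n" for k
    using x y that by (auto simp: cube_def PiE_iff extensional_def)
  have "f x \<le> f (?z k)" if "k \<le> n" for k
    using that
  proof (induction k)
    case (Suc k)
    then have "k < n" by simp
    have "f (?z k) \<le> f (?z (Suc k))"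
    proof (cases "x k = y k")
      case True
      then have "?z (Suc k) = ?z k" by (auto simp: fun_eq_iff less_Suc_eq)
      then show ?thesis by (simp only: order_refl)
    next
      case False
      then have "x k = -1" "y k = 1"
        using le \<open>k < n\<close> cubeD[OF x \<open>k < n\<close>] cubeD[OF y \<open>k < n\<close>] by force+
      then have "(?z k)(k := -1) = ?z k" "(?z k)(k := 1) = ?z (Suc k)"
        by (auto simp: fun_eq_iff less_Suc_eq)
      then show ?thesis
        using mono[OF \<open>k < n\<close>] z[of k] \<open>k < n\<close> unfolding coord_monotone_def by fastforce
    qed
    with Suc show ?case by simp
  qed simp
  moreover have "?z n = y"
    using x y by (simp add: fun_eq_iff cube_def PiE_iff extensional_def)
  ultimately show "f x \<le> f y" by (metis order_refl)
qed

section \<open>Optimal protocols\<close>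

text \<open>Without a balanced function the supremum defining the optimal value would be over the empty
  set.\<close>

lemma balanced_dictator:
  assumes "1 \<le> n"
  shows "balanced n (\<lambda>x. x 0)"
proof -
  have "0 < n" using assms by simp
  let ?A = "\<lambda>b. {x \<in> cube n. x 0 = b}"
  have "card (?A (-1)) = card (?A 1)"
    using sum_cube_flip[OF \<open>0 < n\<close>, of "\<lambda>x. of_bool (x 0 = 1)"] finite_cube
    by (simp add: sum.inter_filter[symmetric] of_bool_def minus_equation_iff[of _ 1] eq_commute[of "-1"])
  moreover have "card (?A (-1)) + card (?A 1) = card (cube n)"
  proof -
    have "cube n = ?A (-1) \<union> ?A 1" using cubeD[OF _ \<open>0 < n\<close>] by auto
    moreover have "?A (-1) \<inter> ?A 1 = {}" by auto
    ultimately show ?thesis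
      using finite_cube by (metis (no_types, lifting) card_Un_disjoint finite_Un)
  qed
  moreover have "card (cube n) = 2 * 2 ^ (n - 1)"
    using \<open>0 < n\<close> by (simp add: cube_def card_PiE numeral_2_eq_2 power_Suc[symmetric] del: power_Suc)
  ultimately show ?thesis
    using cubeD[OF _ \<open>0 < n\<close>] by (auto simp: balanced_def)
qed

text \<open>There are infinitely many protocols, as functions are not restricted off the cube, but each
  agreement probability is the measure of one of finitely many events.\<close>

lemma finite_agree_probs:
  assumes "finite V"
  shows "finite (agree_prob V E \<rho> n S ` P)"
proof (rule finite_subset)
  show "finite (measure (nicd_measure V E \<rho> n) ` Pow (V \<rightarrow>\<^sub>E cube n))"
    using assms finite_cube by (simp add: finite_PiE)
  show "agree_prob V E \<rho> n S ` P \<subseteq> measure (nicd_measure V E \<rho> n) ` Pow (V \<rightarrow>\<^sub>E cube n)"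
    by (auto simp: agree_prob_def nicd_measure_def space_point_measure)
qed

lemma optimal_protocol_exists:
  assumes "finite V" "1 \<le> n"
  shows "\<exists>f. optimal_protocol V E \<rho> n S f"
proof -
  let ?P = "{f. protocol n S f}"
  let ?\<mu> = "agree_prob V E \<rho> n S"
  have fin: "finite (?\<mu> ` ?P)" by (rule finite_agree_probs[OF assms(1)])
  have "(\<lambda>_ x. x 0) \<in> ?P"
    using balanced_dictator[OF assms(2)] by (simp add: protocol_def)
  then have nonempty: "?\<mu> ` ?P \<noteq> {}" by blast
  have "Sup (?\<mu> ` ?P) \<in> ?\<mu> ` ?P"
    unfolding cSup_eq_Max[OF fin nonempty] by (rule Max_in[OF fin nonempty])
  then obtain f where "f \<in> ?P" "?\<mu> f = Sup (?\<mu> ` ?P)" by (metis imageE)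
  then show ?thesis
    unfolding optimal_protocol_def max_agree_prob_def by blast
qed

lemma optimal_protocol_up_shift:
  assumes G: "simple_graph V E" and \<rho>: "0 \<le> \<rho>" "\<rho> \<le> 1" and "S \<subseteq> V" "i < n"
    and opt: "optimal_protocol V E \<rho> n S f"
  shows "optimal_protocol V E \<rho> n S (\<lambda>v. up_shift i (f v))"
proof -
  let ?\<mu> = "agree_prob V E \<rho> n S" and ?g = "\<lambda>v. up_shift i (f v)"
  have f: "protocol n S f" and max: "?\<mu> f = max_agree_prob V E \<rho> n S"
    using opt by (auto simp: optimal_protocol_def)
  then have g: "protocol n S ?g"
    using \<open>i < n\<close> by (simp add: protocol_def balanced_up_shift)
  have "?\<mu> f \<le> ?\<mu> ?g"
    using f by (intro agree_prob_up_shift assms) (auto simp: protocol_def balanced_def Pi_iff)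
  moreover have "?\<mu> ?g \<le> max_agree_prob V E \<rho> n S"
  proof -
    have "bdd_above (?\<mu> ` {f. protocol n S f})"
      using G by (intro bdd_above_finite finite_agree_probs) (simp add: simple_graph_def)
    then show ?thesis
      unfolding max_agree_prob_def using g by (intro cSUP_upper) auto
  qed
  ultimately show ?thesis
    using g max by (simp add: optimal_protocol_def)
qed

theorem theorem6p3:
  fixes V :: "'v set" and E :: "'v set set" and \<rho> :: real and n :: nat and S :: "'v set"
  assumes "is_tree V E"
    and "0 < \<rho>" and "\<rho> < 1"
    and "1 \<le> n"
    and "S \<subseteq> V"
  shows "\<exists>f. optimal_protocol V E \<rho> n S f \<and> (\<forall>v\<in>S. cube_monotone n (f v))"
proof -
  have G: "simple_graph V E" using assms(1) by (simp add: is_tree_def)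
  have "\<exists>f. optimal_protocol V E \<rho> n S f \<and> (\<forall>v\<in>S. \<forall>i<k. coord_monotone n i (f v))"
    if "k \<le> n" for k
    using that
  proof (induction k)
    case 0
    then show ?case
      using optimal_protocol_exists[of V n E \<rho> S] G assms(4) by (auto simp: simple_graph_def)
  next
    case (Suc k)
    then obtain f where opt: "optimal_protocol V E \<rho> n S f"
      and mono: "\<forall>v\<in>S. \<forall>i<k. coord_monotone n i (f v)" by auto
    have "optimal_protocol V E \<rho> n S (\<lambda>v. up_shift k (f v))"
      using assms Suc.prems by (intro optimal_protocol_up_shift[OF G _ _ _ _ opt]) auto
    moreover have "\<forall>v\<in>S. \<forall>i<Suc k. coord_monotone n i (up_shift k (f v))"
      using mono Suc.prems
      by (auto simp: less_Suc_eq coord_monotone_up_shift intro: coord_monotone_up_shift_other)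
    ultimately show ?case by blast
  qed
  then show ?thesis
    using cube_monotoneI by (meson order_refl)
qed

end
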